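(* For every integer $n\ge0$, the element $\Psi_n$ is a primitive element of $\mathbf{sNSym}$, i.e. $\Delta(\Psi_n)=\Psi_n\otimes1+1\otimes\Psi_n$.
   Context: $\mathbf{sNSym}$ is the free associative unital $\mathbb Q$-algebra on generators $H_n$ ($n\ge1$) and $\tilde H_n$ ($n\ge0$), with $H_0=1$. It is graded by fermionic degree $\mathrm{df}$, with $\mathrm{df}(H_n)=0$, $\mathrm{df}(\tilde H_n)=1$. The space $\mathbf{sNSym}\otimes\mathbf{sNSym}$ is an algebra via $(f_1\otimes g_1)(f_2\otimes g_2)=(-1)^{\mathrm{df}(g_1)\mathrm{df}(f_2)}f_1f_2\otimes g_1g_2$ for $\mathrm{df}$-homogeneous elements. The coproduct $\Delta$ is the algebra morphism with $\Delta(H_n)=\sum_{k=0}^nH_k\otimes H_{n-k}$ and $\Delta(\tilde H_n)=\sum_{k=0}^n(\tilde H_k\otimes H_{n-k}+H_{n-k}\otimes\tilde H_k)$. The elements $\Psi_n$ are defined recursively by $\Psi_0=\tilde H_0$ and $\Psi_n=\tilde H_n-\sum_{k=0}^{n-1}H_{n-k}\Psi_k$ for $n\ge1$. *)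

theory Defs
  imports Complex_Main "HOL-Library.Poly_Mapping"
begin

text \<open>The letter \<open>HGen n\<close> stands for the generator \<open>H\<^bsub>n+1\<^esub>\<close> (there is no generator \<open>H\<^sub>0\<close>),
  the letter \<open>HtGen n\<close> for the fermionic generator with index \<open>n\<close>.\<close>

datatype letter = HGen nat | HtGen nat

text \<open>Words form the free monoid under concatenation; the convolution product that
  \<^theory>\<open>HOL-Library.Poly_Mapping\<close> puts on finitely supported functions is then the product of
  the free associative unital algebra.\<close>

instantiation list :: (type) monoid_add
begin

definition zero_list :: "'a list" where "zero_list = []"

definition plus_list :: "'a list \<Rightarrow> 'a list \<Rightarrow> 'a list" where "plus_list u v = u @ v"

instance by standard (simp_all add: zero_list_def plus_list_def)

end

type_synonym snsym = "letter list \<Rightarrow>\<^sub>0 rat"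

definition H :: "nat \<Rightarrow> snsym" where
  "H n = (if n = 0 then 1 else Poly_Mapping.single [HGen (n - 1)] 1)"

definition Ht :: "nat \<Rightarrow> snsym" where
  "Ht n = Poly_Mapping.single [HtGen n] 1"

primrec df_letter :: "letter \<Rightarrow> nat" where
  "df_letter (HGen n) = 0"
| "df_letter (HtGen n) = 1"

definition df :: "letter list \<Rightarrow> nat" where
  "df w = sum_list (map df_letter w)"

definition df_homogeneous :: "nat \<Rightarrow> snsym \<Rightarrow> bool" where
  "df_homogeneous d f \<longleftrightarrow> (\<forall>w \<in> Poly_Mapping.keys f. df w = d)"

text \<open>The tensor square has the pairs of words as a basis. It is made a separate type since its
  product is not the convolution product but carries the sign of the super tensor product.\<close>

typedef snsym2 = "UNIV :: (letter list \<times> letter list \<Rightarrow>\<^sub>0 rat) set" ..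

setup_lifting type_definition_snsym2

lift_definition scale2 :: "rat \<Rightarrow> snsym2 \<Rightarrow> snsym2"
  is "\<lambda>c. Poly_Mapping.map ((*) c)" .

lift_definition tensor :: "snsym \<Rightarrow> snsym \<Rightarrow> snsym2"  (infixr \<open>\<otimes>\<close> 72)
  is "\<lambda>f g. \<Sum>u \<in> Poly_Mapping.keys f. \<Sum>v \<in> Poly_Mapping.keys g.
        Poly_Mapping.single (u, v) (Poly_Mapping.lookup f u * Poly_Mapping.lookup g v)" .

text \<open>The bilinear extension of the sign rule on pairs of words; \<open>tensor_mult_tensor\<close> below is the
  rule for arbitrary homogeneous elements.\<close>

definition super_mult ::
  "(letter list \<times> letter list \<Rightarrow>\<^sub>0 rat) \<Rightarrow> (letter list \<times> letter list \<Rightarrow>\<^sub>0 rat) \<Rightarrow>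
   (letter list \<times> letter list \<Rightarrow>\<^sub>0 rat)" where
  "super_mult s t =
     (\<Sum>p \<in> Poly_Mapping.keys s. \<Sum>q \<in> Poly_Mapping.keys t.
        Poly_Mapping.single (fst p @ fst q, snd p @ snd q)
          ((- 1) ^ (df (snd p) * df (fst q)) * (Poly_Mapping.lookup s p * Poly_Mapping.lookup t q)))"

lemma keys_subset_induct [consumes 1, case_names zero single add]:
  fixes f :: "'a \<Rightarrow>\<^sub>0 'b::comm_monoid_add"
  assumes "Poly_Mapping.keys f \<subseteq> S"
    and zero: "P 0"
    and single: "\<And>k c. k \<in> S \<Longrightarrow> P (Poly_Mapping.single k c)"
    and add: "\<And>a b. P a \<Longrightarrow> P b \<Longrightarrow> P (a + b)"
  shows "P f"
proof -
  have "f = (\<Sum>k\<in>Poly_Mapping.keys f. Poly_Mapping.single k (Poly_Mapping.lookup f k))"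
    by (rule poly_mapping_eqI)
      (auto simp: lookup_sum lookup_single when_def in_keys_iff sum.delta)
  moreover have "P (\<Sum>k\<in>K. Poly_Mapping.single k (Poly_Mapping.lookup f k))"
    if "finite K" "K \<subseteq> S" for K
    using that by (induction K rule: finite_induct) (auto intro: zero single add)
  ultimately show ?thesis
    using assms(1) by (metis finite_keys)
qed

lemmas pm_induct [case_names zero single add] = keys_subset_induct [OF subset_UNIV, simplified]

lemma lookup_map_scale:
  "Poly_Mapping.lookup (Poly_Mapping.map ((*) (c::rat)) f) k = c * Poly_Mapping.lookup f k"
  by (simp add: Poly_Mapping.map.rep_eq when_def)

lemma map_scale_add:
  "Poly_Mapping.map ((*) (c::rat)) (f + g) =
     Poly_Mapping.map ((*) c) f + Poly_Mapping.map ((*) c) g"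
  by (rule poly_mapping_eqI) (simp add: lookup_map_scale lookup_add distrib_left)

lemma map_scale_zero [simp]: "Poly_Mapping.map ((*) (c::rat)) 0 = 0"
  by (rule poly_mapping_eqI) (simp add: lookup_map_scale)

lemma super_mult_zero [simp]: "super_mult 0 t = 0" "super_mult s 0 = 0"
  by (simp_all add: super_mult_def)

lemma super_mult_single [simp]:
  "super_mult (Poly_Mapping.single p a) (Poly_Mapping.single q b) =
     Poly_Mapping.single (fst p @ fst q, snd p @ snd q) ((- 1) ^ (df (snd p) * df (fst q)) * (a * b))"
  by (simp add: super_mult_def)

lemma super_mult_add_left: "super_mult (s + s') t = super_mult s t + super_mult s' t"
  unfolding super_mult_def
  by (rule setsum_keys_plus_distrib [where f = "\<lambda>p a. \<Sum>q \<in> Poly_Mapping.keys t.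
        Poly_Mapping.single (fst p @ fst q, snd p @ snd q)
          ((- 1) ^ (df (snd p) * df (fst q)) * (a * Poly_Mapping.lookup t q))"])
    (simp_all add: distrib_left distrib_right single_add flip: sum.distrib)

lemma super_mult_add_right: "super_mult s (t + t') = super_mult s t + super_mult s t'"
  unfolding super_mult_def sum.distrib [symmetric]
proof (rule sum.cong [OF refl], goal_cases)
  case (1 p)
  show ?case
    by (rule setsum_keys_plus_distrib [where f = "\<lambda>q b.
          Poly_Mapping.single (fst p @ fst q, snd p @ snd q)
            ((- 1) ^ (df (snd p) * df (fst q)) * (Poly_Mapping.lookup s p * b))"])
      (simp_all add: distrib_left single_add)
qed

lemma df_append [simp]: "df (u @ v) = df u + df v"
  by (simp add: df_def)

lemma df_Nil [simp]: "df [] = 0"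
  by (simp add: df_def)

lemma super_mult_assoc: "super_mult (super_mult r s) t = super_mult r (super_mult s t)"
proof (induction r rule: pm_induct)
  case (single p a)
  show ?case
  proof (induction s rule: pm_induct)
    case (single q b)
    show ?case
      by (induction t rule: pm_induct)
        (simp_all add: super_mult_add_right power_add algebra_simps)
  qed (simp_all add: super_mult_add_left super_mult_add_right)
qed (simp_all add: super_mult_add_left)

lemma super_mult_one:
  "super_mult (Poly_Mapping.single ([], []) 1) t = t"
  "super_mult t (Poly_Mapping.single ([], []) 1) = t"
  by (induction t rule: pm_induct; simp add: super_mult_add_left super_mult_add_right)+

instantiation snsym2 :: ring_1
begin

lift_definition zero_snsym2 :: snsym2 is 0 .
lift_definition plus_snsym2 :: "snsym2 \<Rightarrow> snsym2 \<Rightarrow> snsym2" is "(+)" .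
lift_definition minus_snsym2 :: "snsym2 \<Rightarrow> snsym2 \<Rightarrow> snsym2" is "(-)" .
lift_definition uminus_snsym2 :: "snsym2 \<Rightarrow> snsym2" is uminus .
lift_definition one_snsym2 :: snsym2 is "Poly_Mapping.single ([], []) 1" .
lift_definition times_snsym2 :: "snsym2 \<Rightarrow> snsym2 \<Rightarrow> snsym2" is super_mult .

instance
proof
  show "(0::snsym2) \<noteq> 1"
    by transfer (metis single_zero inj_single injD zero_neq_one lookup_single_eq lookup_zero)
qed (transfer; simp add: super_mult_assoc super_mult_one super_mult_add_left
      super_mult_add_right algebra_simps)+

end

lemma scale2_add: "scale2 c (s + t) = scale2 c s + scale2 c t"
  by transfer (rule map_scale_add)

lemma scale2_zero [simp]: "scale2 c 0 = 0" "scale2 0 t = 0"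
  by (transfer, rule poly_mapping_eqI, simp add: lookup_map_scale)+

lemma scale2_one [simp]: "scale2 1 t = t"
  by (transfer, rule poly_mapping_eqI, simp add: lookup_map_scale)

lemma scale2_add_left: "scale2 (a + b) t = scale2 a t + scale2 b t"
  by (transfer, rule poly_mapping_eqI, simp add: lookup_map_scale lookup_add distrib_right)

lemma scale2_scale2 [simp]: "scale2 a (scale2 b t) = scale2 (a * b) t"
  by (transfer, rule poly_mapping_eqI, simp add: lookup_map_scale)

lemma scale2_mult_left: "scale2 c s * t = scale2 c (s * t)"
proof transfer
  fix c :: rat and s t :: "letter list \<times> letter list \<Rightarrow>\<^sub>0 rat"
  show "super_mult (Poly_Mapping.map ((*) c) s) t = Poly_Mapping.map ((*) c) (super_mult s t)"
  proof (induction s rule: pm_induct)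
    case (single p a)
    show ?case
      by (induction t rule: pm_induct) (simp_all add: super_mult_add_right map_scale_add mult.left_commute mult.assoc)
  qed (simp_all add: super_mult_add_left map_scale_add)
qed

lemma scale2_mult_right: "s * scale2 c t = scale2 c (s * t)"
proof transfer
  fix c :: rat and s t :: "letter list \<times> letter list \<Rightarrow>\<^sub>0 rat"
  show "super_mult s (Poly_Mapping.map ((*) c) t) = Poly_Mapping.map ((*) c) (super_mult s t)"
  proof (induction s rule: pm_induct)
    case (single p a)
    show ?case
      by (induction t rule: pm_induct) (simp_all add: super_mult_add_right map_scale_add mult.left_commute mult.assoc)
  qed (simp_all add: super_mult_add_left map_scale_add)
qed

lemma tensor_zero [simp]: "0 \<otimes> g = 0" "f \<otimes> 0 = 0"
proof -
  show "0 \<otimes> g = 0" by transfer simp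
  show "f \<otimes> 0 = 0" by transfer simp
qed

lemma tensor_add_left: "(f + f') \<otimes> g = f \<otimes> g + f' \<otimes> g"
  by (transfer, rule setsum_keys_plus_distrib [where f = "\<lambda>u a. \<Sum>v \<in> Poly_Mapping.keys g.
        Poly_Mapping.single (u, v) (a * Poly_Mapping.lookup g v)" for g])
    (simp_all add: distrib_right single_add flip: sum.distrib)

lemma tensor_add_right: "f \<otimes> (g + g') = f \<otimes> g + f \<otimes> g'"
proof (transfer, unfold sum.distrib [symmetric], rule sum.cong [OF refl], goal_cases)
  case (1 f g g' u)
  show ?case
    by (rule setsum_keys_plus_distrib [where f = "\<lambda>v b.
          Poly_Mapping.single (u, v) (Poly_Mapping.lookup f u * b)"])
      (simp_all add: distrib_left single_add)
qed

lemma tensor_single_mult: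
  "(Poly_Mapping.single u a \<otimes> Poly_Mapping.single v b) *
   (Poly_Mapping.single u' a' \<otimes> Poly_Mapping.single v' b') =
   scale2 ((- 1) ^ (df v * df u'))
     (Poly_Mapping.single (u @ u') (a * a') \<otimes> Poly_Mapping.single (v @ v') (b * b'))"
  by (simp add: Rep_snsym2_inject [symmetric] times_snsym2.rep_eq tensor.rep_eq scale2.rep_eq
      mult.left_commute mult.assoc)

lemma one_snsym: "1 = (Poly_Mapping.single [] 1 :: snsym)"
  by (metis single_one zero_list_def)

lemma one_tensor_one: "1 \<otimes> 1 = 1"
  by (simp add: one_snsym Rep_snsym2_inject [symmetric] one_snsym2.rep_eq tensor.rep_eq)

lemma tensor_mult_tensor:
  assumes "df_homogeneous d g\<^sub>1" "df_homogeneous e f\<^sub>2"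
  shows "(f\<^sub>1 \<otimes> g\<^sub>1) * (f\<^sub>2 \<otimes> g\<^sub>2) = scale2 ((- 1) ^ (d * e)) ((f\<^sub>1 * f\<^sub>2) \<otimes> (g\<^sub>1 * g\<^sub>2))"
proof -
  have g: "Poly_Mapping.keys g\<^sub>1 \<subseteq> {w. df w = d}" and f: "Poly_Mapping.keys f\<^sub>2 \<subseteq> {w. df w = e}"
    using assms by (auto simp: df_homogeneous_def)
  note add = tensor_add_left tensor_add_right scale2_add distrib_left distrib_right
  show ?thesis
  proof (induction f\<^sub>1 rule: pm_induct)
    case (single u a)
    show ?case
      using g
    proof (induction g\<^sub>1 rule: keys_subset_induct)
      case (single v b)
      note v = single
      show ?case
        using f
      proof (induction f\<^sub>2 rule: keys_subset_induct)
        case (single u' a')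
        then show ?case
          using v by (induction g\<^sub>2 rule: pm_induct)
            (simp_all add: tensor_single_mult mult_single plus_list_def add)
      qed (simp_all add: add)
    qed (simp_all add: add)
  qed (simp_all add: add)
qed

primrec Delta_letter :: "letter \<Rightarrow> snsym2" where
  "Delta_letter (HGen n) = (\<Sum>k = 0..n + 1. H k \<otimes> H (n + 1 - k))"
| "Delta_letter (HtGen n) = (\<Sum>k = 0..n. Ht k \<otimes> H (n - k) + H (n - k) \<otimes> Ht k)"

text \<open>The algebra morphism determined by its values on the generators: multiplicative on words,
  extended linearly (see \<open>Delta_unique\<close>).\<close>

definition Delta :: "snsym \<Rightarrow> snsym2" where
  "Delta f = (\<Sum>w \<in> Poly_Mapping.keys f.
     scale2 (Poly_Mapping.lookup f w) (prod_list (map Delta_letter w)))"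

lemma Delta_zero [simp]: "Delta 0 = 0"
  by (simp add: Delta_def)

lemma Delta_add: "Delta (f + g) = Delta f + Delta g"
  unfolding Delta_def
  by (rule setsum_keys_plus_distrib
      [where f = "\<lambda>w c. scale2 c (prod_list (map Delta_letter w))"])
    (simp_all add: scale2_add_left)

lemma Delta_single:
  "Delta (Poly_Mapping.single w c) = scale2 c (prod_list (map Delta_letter w))"
  by (simp add: Delta_def)

lemma Delta_scale: "Delta (Poly_Mapping.map ((*) c) f) = scale2 c (Delta f)"
  by (induction f rule: pm_induct) (simp_all add: Delta_single Delta_add map_scale_add scale2_add)

lemma Delta_one: "Delta 1 = 1"
  by (simp add: one_snsym Delta_single)

lemma Delta_mult: "Delta (f * g) = Delta f * Delta g"
proof (induction f rule: pm_induct)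
  case (single w c)
  show ?case
    by (induction g rule: pm_induct)
      (simp_all add: Delta_single Delta_add mult_single plus_list_def
        scale2_mult_left scale2_mult_right algebra_simps)
qed (simp_all add: Delta_add distrib_right)

lemma Delta_H: "Delta (H n) = (\<Sum>k = 0..n. H k \<otimes> H (n - k))"
proof (cases n)
  case 0
  then show ?thesis by (simp add: H_def Delta_one one_tensor_one)
next
  case (Suc m)
  then have "Delta (H n) = Delta_letter (HGen m)"
    by (simp add: H_def Delta_single)
  then show ?thesis
    by (simp add: Suc)
qed

lemma Delta_Ht: "Delta (Ht n) = (\<Sum>k = 0..n. Ht k \<otimes> H (n - k) + H (n - k) \<otimes> Ht k)"
  by (simp add: Ht_def [of n] Delta_single)

lemma Delta_unique:
  assumes add: "\<And>f g. D (f + g) = D f + D g"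
    and scale: "\<And>c f. D (Poly_Mapping.map ((*) c) f) = scale2 c (D f)"
    and one: "D 1 = 1"
    and mult: "\<And>f g. D (f * g) = D f * D g"
    and H: "\<And>n. D (H n) = (\<Sum>k = 0..n. H k \<otimes> H (n - k))"
    and Ht: "\<And>n. D (Ht n) = (\<Sum>k = 0..n. Ht k \<otimes> H (n - k) + H (n - k) \<otimes> Ht k)"
  shows "D = Delta"
proof
  fix f
  have letter: "D (Poly_Mapping.single [x] 1) = Delta_letter x" for x
  proof (cases x)
    case (HGen n)
    then show ?thesis using H [of "Suc n"] by (simp add: H_def [of "Suc n"])
  next
    case (HtGen n)
    then show ?thesis using Ht [of n] by (simp add: Ht_def [of n])
  qed
  have word: "D (Poly_Mapping.single w 1) = prod_list (map Delta_letter w)" for w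
  proof (induction w)
    case Nil
    then show ?case using one by (simp add: one_snsym)
  next
    case (Cons x w)
    have "D (Poly_Mapping.single (x # w) 1) =
        D (Poly_Mapping.single [x] 1 * Poly_Mapping.single w 1)"
      by (simp add: mult_single plus_list_def)
    then show ?case by (simp add: mult letter Cons)
  qed
  show "D f = Delta f"
  proof (induction f rule: pm_induct)
    case zero
    then show ?case using add [of 0 0] by simp
  next
    case (single w c)
    then show ?case using scale [of c "Poly_Mapping.single w 1"] by (simp add: word Delta_single)
  qed (simp_all add: add Delta_add)
qed

definition primitive :: "snsym \<Rightarrow> bool" where
  "primitive f \<longleftrightarrow> Delta f = f \<otimes> 1 + 1 \<otimes> f"

fun Psi :: "nat \<Rightarrow> snsym" where
  "Psi 0 = Ht 0"
| "Psi (Suc n) = Ht (Suc n) - (\<Sum>k = 0..n. H (Suc n - k) * Psi k)"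

end

theory Submission
  imports Defs
begin

text \<open>Solved for \<open>Ht n\<close>, the recursion reads \<open>Ht n = (\<Sum>k = 0..n. H (n - k) * Psi k)\<close>: as generating
  series, \<open>Ht = H \<cdot> Psi\<close> (lemma \<open>Ht_eq_sum_H_Psi\<close>). Write \<open>X k = Psi k \<otimes> 1 + 1 \<otimes> Psi k\<close> for the
  coproduct that a primitive \<open>Psi k\<close> must have. Applying \<open>Delta\<close> to this identity gives
  \<open>Delta (Ht n) = (\<Sum>k = 0..n. Delta (H (n - k)) * Delta (Psi k))\<close>. On the other hand, each \<open>H n\<close> is
  even, so no sign appears in \<open>Delta (H m) * X k\<close>; expanding that product, exchanging sums and
  collecting the factors \<open>H \<cdot> Psi\<close> back into \<open>Ht\<close> turns \<open>\<Sum>k = 0..n. Delta (H (n - k)) * X k\<close> into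
  the defining formula for \<open>Delta (Ht n)\<close> as well (lemma \<open>Delta_Ht_eq_sum\<close>). So the sequences
  \<open>Delta (Psi k)\<close> and \<open>X k\<close> have the same convolution with \<open>Delta (H m)\<close>. As \<open>Delta (H 0) = 1\<close>,
  convolution with \<open>Delta (H m)\<close> can be cancelled, and the two sequences agree.\<close>

lemma Ht_eq_sum_H_Psi: "Ht n = (\<Sum>k = 0..n. H (n - k) * Psi k)"
proof (cases n)
  case 0
  then show ?thesis by (simp add: H_def)
next
  case (Suc m)
  then show ?thesis by (simp add: H_def [of 0])
qed

lemma tensor_sum_left: "(\<Sum>i\<in>A. f i) \<otimes> g = (\<Sum>i\<in>A. f i \<otimes> g)"
  by (induction A rule: infinite_finite_induct) (simp_all add: tensor_add_left)

lemma tensor_sum_right: "f \<otimes> (\<Sum>i\<in>A. g i) = (\<Sum>i\<in>A. f \<otimes> g i)"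
  by (induction A rule: infinite_finite_induct) (simp_all add: tensor_add_right)

lemma Delta_sum: "Delta (\<Sum>i\<in>A. f i) = (\<Sum>i\<in>A. Delta (f i))"
  by (induction A rule: infinite_finite_induct) (simp_all add: Delta_add)

lemma df_homogeneous_H: "df_homogeneous 0 (H n)"
  by (simp add: df_homogeneous_def H_def one_snsym df_def)

lemma sum_triangle_swap:
  fixes f :: "nat \<Rightarrow> nat \<Rightarrow> 'a::comm_monoid_add"
  shows "(\<Sum>k = 0..n. \<Sum>j = 0..n - k. f k j) = (\<Sum>j = 0..n. \<Sum>k = 0..n - j. f k j)"
  unfolding sum.Sigma [OF finite_atLeastAtMost ballI [OF finite_atLeastAtMost]]
  by (rule sum.reindex_bij_witness [where i = prod.swap and j = prod.swap]) auto

text \<open>The sign comes from moving \<open>H j\<close> past \<open>g\<close>, and \<open>H j\<close> is even. The element \<open>g\<close> may be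
  inhomogeneous: it is split into words, to each of which the sign rule applies.\<close>

lemma tensor_H_mult_tensor: "(f \<otimes> H j) * (g \<otimes> h) = (f * g) \<otimes> (H j * h)"
proof (induction g rule: pm_induct)
  case (single w c)
  have "df_homogeneous (df w) (Poly_Mapping.single w c)"
    by (simp add: df_homogeneous_def)
  then show ?case
    by (simp add: tensor_mult_tensor [OF df_homogeneous_H])
qed (simp_all add: tensor_add_left distrib_left)

lemma Delta_H_mult_primitive:
  "Delta (H m) * (P \<otimes> 1 + 1 \<otimes> P) =
     (\<Sum>j = 0..m. (H (m - j) * P) \<otimes> H j + H j \<otimes> (H (m - j) * P))"
proof -
  have "Delta (H m) * (P \<otimes> 1) = (\<Sum>j = 0..m. (H j * P) \<otimes> H (m - j))"
    by (simp add: Delta_H sum_distrib_right tensor_H_mult_tensor)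
  also have "\<dots> = (\<Sum>j = 0..m. (H (m - j) * P) \<otimes> H j)"
    by (subst sum.atLeastAtMost_rev) simp
  finally show ?thesis
    by (simp add: Delta_H sum_distrib_right tensor_H_mult_tensor distrib_left sum.distrib)
qed

lemma Delta_Ht_eq_sum:
  "Delta (Ht n) = (\<Sum>k = 0..n. Delta (H (n - k)) * (Psi k \<otimes> 1 + 1 \<otimes> Psi k))"
proof -
  have "(\<Sum>k = 0..n. Delta (H (n - k)) * (Psi k \<otimes> 1 + 1 \<otimes> Psi k)) =
      (\<Sum>j = 0..n. \<Sum>k = 0..n - j.
        (H (n - k - j) * Psi k) \<otimes> H j + H j \<otimes> (H (n - k - j) * Psi k))"
    unfolding Delta_H_mult_primitive by (rule sum_triangle_swap)
  also have "\<dots> = (\<Sum>j = 0..n. Ht (n - j) \<otimes> H j + H j \<otimes> Ht (n - j))"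
    by (simp add: Ht_eq_sum_H_Psi tensor_sum_left tensor_sum_right sum.distrib add.commute)
  also have "\<dots> = Delta (Ht n)"
    unfolding Delta_Ht by (subst sum.atLeastAtMost_rev) simp
  finally show ?thesis by simp
qed

text \<open>The equations form a triangular system with \<open>a 0 = 1\<close> on the diagonal.\<close>

lemma convolution_left_cancel:
  fixes a x y :: "nat \<Rightarrow> 'a::ring_1"
  assumes "a 0 = 1"
    and eq: "\<And>n. (\<Sum>k = 0..n. a (n - k) * x k) = (\<Sum>k = 0..n. a (n - k) * y k)"
  shows "x n = y n"
proof (induction n rule: less_induct)
  case (less n)
  have split: "(\<Sum>k = 0..n. a (n - k) * z k) = (\<Sum>k<n. a (n - k) * z k) + z n"
    for z :: "nat \<Rightarrow> 'a"
    by (simp add: assms(1) atLeast0AtMost flip: lessThan_Suc_atMost)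
  show ?case
    using eq [of n] less by (simp add: split)
qed

theorem proposition4p6:
  fixes n :: nat
  shows "primitive (Psi n)"
  unfolding primitive_def
proof (rule convolution_left_cancel [where a = "\<lambda>m. Delta (H m)"])
  show "Delta (H 0) = 1"
    by (simp add: H_def Delta_one)
  show "(\<Sum>k = 0..m. Delta (H (m - k)) * Delta (Psi k)) =
      (\<Sum>k = 0..m. Delta (H (m - k)) * (Psi k \<otimes> 1 + 1 \<otimes> Psi k))" for m
    by (simp only: Delta_Ht_eq_sum [symmetric] Ht_eq_sum_H_Psi Delta_sum Delta_mult)
qed

end
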